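(* Let $J,K,N$ be positive integers, $\bar P>0$, let $\boldsymbol{\beta},\mathbf{w},\boldsymbol{\sigma}\in\mathbb{R}_{++}^{JK}$, and let $d_{m,n}>0$ for $m,n\in\{1,\dots,JK\}$. For a given $\hat{\boldsymbol{\phi}}\in\mathbb{R}_{++}^{JK}$, consider the optimization problem $$\text{maximize}\quad \min_{m}\ \frac{\hat q_m d_{m,m}}{\beta_m\Big(w_m+\frac1N\sum_{n\ne m}\frac{\hat q_n d_{m,n}}{1+\hat q_n d_{m,n}\hat\phi_m}\Big)}\qquad\text{subject to}\quad \tfrac1N\boldsymbol{\sigma}^{\mathsf T}\hat{\mathbf{q}}\le\bar P,\ \ \hat{\mathbf{q}}>0,$$ in the variable $\hat{\mathbf{q}}\in\mathbb{R}^{JK}$. Starting from any initial $\hat{\mathbf{q}}[0]\in\mathbb{R}_{++}^{JK}$ with $\frac1N\boldsymbol{\sigma}^{\mathsf T}\hat{\mathbf{q}}[0]\le\bar P$, define for $\ell=0,1,2,\dots$: 1. $\hat q_m[\ell+1]=\dfrac{\beta_m}{d_{m,m}}\Big(w_m+\frac1N\sum_{n\ne m}\dfrac{\hat q_n[\ell]d_{m,n}}{1+\hat q_n[\ell]d_{m,n}\hat\phi_m}\Big)$ for all $m$; 2. replace $\hat{\mathbf{q}}[\ell+1]$ by $\dfrac{N\bar P}{\boldsymbol{\sigma}^{\mathsf T}\hat{\mathbf{q}}[\ell+1]}\,\hat{\mathbf{q}}[\ell+1]$. Then $\hat{\mathbf{q}}[\ell]$ converges geometrically fast, as $\ell\to\infty$,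 to the optimal solution $\hat{\mathbf{q}}^*(\hat{\boldsymbol{\phi}})$ of the optimization problem.
   Context: $\mathbb{R}_{++}$ denotes the positive reals; sums over $n\neq m$ run over $n\in\{1,\dots,JK\}\setminus\{m\}$. A sequence $x[\ell]$ converges geometrically fast to $x^*$ if there are constants $C>0$ and $r\in(0,1)$ with $\|x[\ell]-x^*\|\le C r^{\ell}$ for all $\ell$. *)

theory Defs
  imports "HOL-Analysis.Analysis"
begin

(* Componentwise positivity; the library order 0 < x on vectors only means 0 \<le> x and x \<noteq> 0. *)
definition positive_vec :: "real ^ 'n \<Rightarrow> bool" where
  "positive_vec x \<longleftrightarrow> (\<forall>m. 0 < x $ m)"

(* d $ m $ n is d_{m,n}: the first component selects the row. *)
definition interference ::
  "nat \<Rightarrow> real ^ 'n ^ 'n \<Rightarrow> real ^ 'n \<Rightarrow> real ^ 'n \<Rightarrow> real ^ 'n \<Rightarrow> 'n::finite \<Rightarrow> real" where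
  "interference N d w \<phi> q m =
     w $ m + 1 / real N * (\<Sum>n \<in> UNIV - {m}. q $ n * d $ m $ n / (1 + q $ n * d $ m $ n * \<phi> $ m))"

definition min_objective ::
  "nat \<Rightarrow> real ^ 'n ^ 'n \<Rightarrow> real ^ 'n \<Rightarrow> real ^ 'n \<Rightarrow> real ^ 'n \<Rightarrow> real ^ 'n::finite \<Rightarrow> real" where
  "min_objective N d \<beta> w \<phi> q =
     (MIN m. q $ m * d $ m $ m / (\<beta> $ m * interference N d w \<phi> q m))"

definition feasible :: "nat \<Rightarrow> real ^ 'n \<Rightarrow> real \<Rightarrow> real ^ 'n::finite \<Rightarrow> bool" where
  "feasible N \<sigma> P q \<longleftrightarrow> 1 / real N * (\<sigma> \<bullet> q) \<le> P \<and> positive_vec q"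

definition optimal ::
  "nat \<Rightarrow> real ^ 'n ^ 'n \<Rightarrow> real ^ 'n \<Rightarrow> real ^ 'n \<Rightarrow> real ^ 'n \<Rightarrow> real \<Rightarrow> real ^ 'n \<Rightarrow>
   real ^ 'n::finite \<Rightarrow> bool" where
  "optimal N d \<beta> w \<sigma> P \<phi> q \<longleftrightarrow>
     is_arg_max (min_objective N d \<beta> w \<phi>) (feasible N \<sigma> P) q"

definition update ::
  "nat \<Rightarrow> real ^ 'n ^ 'n \<Rightarrow> real ^ 'n \<Rightarrow> real ^ 'n \<Rightarrow> real ^ 'n \<Rightarrow> real ^ 'n \<Rightarrow> real ^ 'n::finite" where
  "update N d \<beta> w \<phi> q = (\<chi> m. \<beta> $ m / d $ m $ m * interference N d w \<phi> q m)"

definition normalize_power :: "nat \<Rightarrow> real ^ 'n \<Rightarrow> real \<Rightarrow> real ^ 'n \<Rightarrow> real ^ 'n::finite" where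
  "normalize_power N \<sigma> P q = (real N * P / (\<sigma> \<bullet> q)) *\<^sub>R q"

definition geometrically_converges :: "(nat \<Rightarrow> 'a::real_normed_vector) \<Rightarrow> 'a \<Rightarrow> bool" where
  "geometrically_converges x l \<longleftrightarrow>
     (\<exists>C r. 0 < C \<and> 0 < r \<and> r < 1 \<and> (\<forall>k. norm (x k - l) \<le> C * r ^ k))"

end

theory Submission
  imports Defs
begin

text \<open>
  The unnormalized update \<open>T\<close> is monotone, concave, bounded on the nonnegative orthant and satisfies
  \<open>T 0 > 0\<close>. Concavity and \<open>T 0 \<ge> \<epsilon> T y\<close> give \<open>T x \<ge> (a + (1 - a) \<epsilon>) T y\<close> whenever \<open>x \<ge> a y\<close> with
  \<open>0 < a \<le> 1\<close>, and the weighted AM-GM inequality turns the factor into \<open>a powr (1 - \<epsilon>)\<close>. Hence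
  \<open>T\<close> contracts the Hilbert projective metric by \<open>1 - \<epsilon>\<close>; this metric does not see the normalization.
  Brouwer's theorem provides a fixed point of the normalized update. A feasible point whose objective
  is at least that of the fixed point dominates it componentwise, again by contractivity, and so the
  power constraint makes the two equal.
\<close>

section \<open>Scalar inequalities: weighted AM-GM and the saturating interference term\<close>

lemma le_powr_of_affine:
  fixes a e :: real
  assumes "0 < a" "0 \<le> e" "e \<le> 1"
  shows "a powr (1 - e) \<le> a + (1 - a) * e"
proof -
  \<comment> \<open>Weighted AM-GM for \<open>a\<close> and 1, as convexity of \<open>exp\<close>
    between \<open>ln a\<close> and \<open>0 = ln 1\<close>.\<close>
  have "exp ((1 - e) * ln a + e * 0) \<le> (1 - e) * exp (ln a) + e * exp 0"
    using assms convex_onD[OF exp_convex, of e "ln a" 0] by simp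
  then show ?thesis
    using assms by (simp add: powr_def algebra_simps)
qed

lemma saturation_mono:
  fixes s t p :: real
  assumes "0 \<le> s" "s \<le> t" "0 < p"
  shows "s / (1 + s * p) \<le> t / (1 + t * p)"
proof -
  have "0 < 1 + s * p" "0 < 1 + t * p"
    using assms by (auto intro!: add_pos_nonneg)
  then show ?thesis
    using assms by (simp add: frac_le_eq divide_nonpos_pos field_simps)
qed

text \<open>Scaling the argument by \<open>a\<close> also shrinks the denominator; this is concavity
  together with the value 0 at 0.\<close>

lemma saturation_scale:
  fixes a t p :: real
  assumes "0 \<le> t" "0 < a" "a \<le> 1" "0 < p"
  shows "a * (t / (1 + t * p)) \<le> (a * t) / (1 + (a * t) * p)"
proof -
  have "0 < 1 + a * t * p" using assms by (auto intro!: add_pos_nonneg)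
  moreover have "1 + a * t * p \<le> 1 + t * p"
    using assms by (simp add: mult_left_le_one_le mult.assoc)
  ultimately show ?thesis
    using assms by (simp add: frac_le)
qed

lemma saturation_le:
  fixes t p :: real
  assumes "0 \<le> t" "0 < p"
  shows "t / (1 + t * p) \<le> 1 / p"
proof -
  have "0 < 1 + t * p" using assms by (auto intro!: add_pos_nonneg)
  then show ?thesis using assms by (simp add: field_simps)
qed

section \<open>The unnormalized update and its contraction property\<close>

locale interference_model =
  fixes N :: nat
    and d :: "real ^ 'n::finite ^ 'n"
    and \<beta> w \<phi> :: "real ^ 'n"
  assumes N: "0 < N"
    and d: "\<And>m n. 0 < d $ m $ n"
    and \<beta>: "\<And>m. 0 < \<beta> $ m"
    and w: "\<And>m. 0 < w $ m"
    and \<phi>: "\<And>m. 0 < \<phi> $ m"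
begin

abbreviation I :: "real ^ 'n \<Rightarrow> 'n \<Rightarrow> real" where
  "I \<equiv> interference N d w \<phi>"

abbreviation T :: "real ^ 'n \<Rightarrow> real ^ 'n" where
  "T \<equiv> update N d \<beta> w \<phi>"

lemma interference_ge:
  assumes "\<And>m. 0 \<le> y $ m"
  shows "w $ m \<le> I y m"
  unfolding interference_def using assms d \<phi>
  by (simp add: sum_nonneg less_imp_le)

lemma interference_pos:
  assumes "\<And>m. 0 \<le> y $ m"
  shows "0 < I y m"
  using interference_ge[OF assms] w[of m] by (rule less_le_trans[rotated])

text \<open>Every summand saturates below \<open>1 / \<phi> $ m\<close>, so the bound is free of
  \<open>y\<close>. This is what allows one contraction exponent for the whole nonnegative
  orthant.\<close>

lemma interference_le:
  assumes "\<And>m. 0 \<le> y $ m"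
  shows "I y m \<le> w $ m + 1 / real N * (\<Sum>n \<in> UNIV - {m}. 1 / \<phi> $ m)"
  unfolding interference_def using assms d \<phi> N
  by (intro add_left_mono mult_left_mono sum_mono saturation_le) (auto simp: less_imp_le)

text \<open>The interference sum is monotone and loses at most the factor \<open>a\<close>, while
  the noise term \<open>w $ m\<close> is not scaled at all. The surplus
  \<open>(1 - a) * w $ m\<close> is the source of strict contraction.\<close>

lemma interference_scale:
  assumes y: "\<And>m. 0 \<le> y $ m" and a: "0 < a" "a \<le> 1" and xy: "\<And>m. a * y $ m \<le> x $ m"
  shows "a * I y m + (1 - a) * w $ m \<le> I x m"
proof -
  have "a * (\<Sum>n \<in> UNIV - {m}. y $ n * d $ m $ n / (1 + y $ n * d $ m $ n * \<phi> $ m))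
      = (\<Sum>n \<in> UNIV - {m}. a * (y $ n * d $ m $ n / (1 + y $ n * d $ m $ n * \<phi> $ m)))"
    by (rule sum_distrib_left)
  also have "\<dots> \<le> (\<Sum>n \<in> UNIV - {m}. x $ n * d $ m $ n / (1 + x $ n * d $ m $ n * \<phi> $ m))"
  proof (rule sum_mono)
    fix n
    have "a * (y $ n * d $ m $ n / (1 + y $ n * d $ m $ n * \<phi> $ m))
        \<le> (a * (y $ n * d $ m $ n)) / (1 + (a * (y $ n * d $ m $ n)) * \<phi> $ m)"
      using y d \<phi> a by (intro saturation_scale) (auto simp: less_imp_le)
    also have "\<dots> \<le> x $ n * d $ m $ n / (1 + x $ n * d $ m $ n * \<phi> $ m)"
    proof (rule saturation_mono)
      show "a * (y $ n * d $ m $ n) \<le> x $ n * d $ m $ n"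
        using mult_right_mono[OF xy[of n], of "d $ m $ n"] d[of m n] by (simp add: mult.assoc)
    qed (use y d \<phi> a in \<open>auto simp: less_imp_le\<close>)
    finally show "a * (y $ n * d $ m $ n / (1 + y $ n * d $ m $ n * \<phi> $ m))
        \<le> x $ n * d $ m $ n / (1 + x $ n * d $ m $ n * \<phi> $ m)" .
  qed
  finally have "1 / real N * (a * (\<Sum>n \<in> UNIV - {m}. y $ n * d $ m $ n / (1 + y $ n * d $ m $ n * \<phi> $ m)))
    \<le> 1 / real N * (\<Sum>n \<in> UNIV - {m}. x $ n * d $ m $ n / (1 + x $ n * d $ m $ n * \<phi> $ m))"
    by (rule mult_left_mono) simp
  then show ?thesis
    unfolding interference_def by (simp add: algebra_simps)
qed

text \<open>The surplus in \<open>interference_scale\<close> is at least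
  \<open>(1 - a) * e * I y m\<close> when \<open>e\<close> is a uniform lower bound for
  \<open>w $ m / I y m\<close>. Then \<open>k = 1 - e\<close> serves all points at once:
  \<open>T\<close> multiplies the logarithm of a ratio bound by \<open>k\<close>.\<close>

lemma ex_contraction_factor:
  "\<exists>k. 0 < k \<and> k < 1 \<and> (\<forall>x y a m. (\<forall>m. 0 \<le> y $ m) \<longrightarrow> 0 < a \<longrightarrow> a \<le> 1 \<longrightarrow>
      (\<forall>m. a * y $ m \<le> x $ m) \<longrightarrow> a powr k * T y $ m \<le> T x $ m)"
proof -
  define M where "M m = w $ m + 1 / real N * (\<Sum>n \<in> UNIV - {m}. 1 / \<phi> $ m)" for m
  have M: "0 < M m" for m
    unfolding M_def using w \<phi> by (intro add_pos_nonneg mult_nonneg_nonneg sum_nonneg) (auto simp: less_imp_le)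
  \<comment> \<open>The entry 1/2 keeps \<open>1 - e\<close> positive: with a single index the
    interference sum is empty and \<open>w $ m / M m\<close> is 1.\<close>
  define e where "e = Min (insert (1/2) (range (\<lambda>m. w $ m / M m)))"
  have e0: "0 < e"
    unfolding e_def using w M by (subst Min_gr_iff) auto
  have e1: "e \<le> 1/2" and e: "e \<le> w $ m / M m" for m
    unfolding e_def by (rule Min_le; simp)+
  have "a powr (1 - e) * T y $ m \<le> T x $ m"
    if y: "\<forall>m. 0 \<le> y $ m" and a: "0 < a" "a \<le> 1" and xy: "\<forall>m. a * y $ m \<le> x $ m" for x y a m
  proof -
    have "e * I y m \<le> e * M m"
      using interference_le[of y m] y e0 by (intro mult_left_mono) (auto simp: M_def)
    also have "\<dots> \<le> w $ m"
      using e[of m] M[of m] by (simp add: field_simps)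
    finally have ew: "e * I y m \<le> w $ m" .
    have "a powr (1 - e) * I y m \<le> (a + (1 - a) * e) * I y m"
      using a e0 e1 interference_pos[of y m] y by (intro mult_right_mono le_powr_of_affine) (auto simp: less_imp_le)
    also have "\<dots> = a * I y m + (1 - a) * (e * I y m)"
      by (simp add: algebra_simps)
    also have "\<dots> \<le> a * I y m + (1 - a) * w $ m"
      using ew a by (intro add_left_mono mult_left_mono) auto
    also have "\<dots> \<le> I x m"
      using y a xy by (intro interference_scale) auto
    finally have "\<beta> $ m / d $ m $ m * (a powr (1 - e) * I y m) \<le> \<beta> $ m / d $ m $ m * I x m"
      using \<beta>[of m] d[of m m] by (intro mult_left_mono) auto
    then show ?thesis
      by (simp add: update_def ac_simps)
  qed
  then show ?thesis
    using e0 e1 by (intro exI[of _ "1 - e"]) auto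
qed

lemma update_pos:
  assumes "\<And>m. 0 \<le> y $ m"
  shows "0 < T y $ m"
  using interference_pos[OF assms] \<beta> d by (simp add: update_def)

lemma continuous_on_update:
  assumes "\<And>x m. x \<in> S \<Longrightarrow> 0 \<le> x $ m"
  shows "continuous_on S T"
proof -
  have "1 + x $ n * d $ m $ n * \<phi> $ m \<noteq> 0" if "x \<in> S" for x m n
  proof -
    have "0 \<le> x $ n * d $ m $ n * \<phi> $ m"
      using assms that d \<phi> by (simp add: less_imp_le)
    then show ?thesis by linarith
  qed
  moreover have "T = (\<lambda>x. \<chi> m. \<beta> $ m / d $ m $ m * I x m)"
    by (simp add: update_def fun_eq_iff)
  ultimately show ?thesis
    using d N unfolding interference_def
    by (auto intro!: continuous_intros simp: less_imp_neq[symmetric])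
qed

text \<open>Links the optimization problem to the iteration: an objective of at least
  \<open>c\<close> means that \<open>q\<close> dominates \<open>c\<close> times \<open>T q\<close>
  in every component.\<close>

lemma min_objective_eq:
  "min_objective N d \<beta> w \<phi> q = (MIN m. q $ m / T q $ m)"
  by (simp add: min_objective_def update_def divide_simps)

section \<open>The power constraint and a fixed point of the normalized update\<close>

context
  fixes \<sigma> :: "real ^ 'n" and P :: real
  assumes \<sigma>: "\<And>m. 0 < \<sigma> $ m" and P: "0 < P"
begin

abbreviation G :: "real ^ 'n \<Rightarrow> real ^ 'n" where
  "G y \<equiv> normalize_power N \<sigma> P (T y)"

lemma weighted_power_pos:
  assumes "\<And>m. 0 < y $ m"
  shows "0 < \<sigma> \<bullet> y"
  unfolding inner_vec_def using assms \<sigma> by (auto intro!: sum_pos)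

lemma weighted_power_mono:
  assumes "\<And>m. x $ m \<le> y $ m"
  shows "\<sigma> \<bullet> x \<le> \<sigma> \<bullet> y"
  unfolding inner_vec_def using assms \<sigma> by (auto intro!: sum_mono mult_left_mono simp: less_imp_le)

text \<open>The weights are strictly positive, so a vanishing weighted sum of nonnegative
  differences leaves no difference.\<close>

lemma weighted_power_mono_eq:
  assumes "\<And>m. x $ m \<le> y $ m" "\<sigma> \<bullet> y \<le> \<sigma> \<bullet> x"
  shows "y = x"
proof -
  have "\<sigma> \<bullet> (y - x) = 0"
    using assms(2) weighted_power_mono[OF assms(1)] by (simp add: inner_diff_right)
  then have "(\<Sum>m\<in>UNIV. \<sigma> $ m * (y $ m - x $ m)) = 0"
    by (simp add: inner_vec_def)
  then have "\<sigma> $ m * (y $ m - x $ m) = 0" for m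
    using assms(1) \<sigma> by (subst (asm) sum_nonneg_eq_0_iff) (auto simp: less_imp_le)
  then have "y $ m = x $ m" for m
    using \<sigma>[of m] by (metis eq_iff_diff_eq_0 less_irrefl mult_eq_0_iff)
  then show ?thesis
    by (simp add: vec_eq_iff)
qed

lemma normalize_scale_pos:
  assumes "\<And>m. 0 \<le> y $ m"
  shows "0 < real N * P / (\<sigma> \<bullet> T y)"
  using N P weighted_power_pos[OF update_pos[OF assms]] by simp

lemma normalized_power:
  assumes "\<And>m. 0 \<le> y $ m"
  shows "\<sigma> \<bullet> G y = real N * P"
  using weighted_power_pos[OF update_pos[OF assms]] by (simp add: normalize_power_def)

lemma normalized_pos:
  assumes "\<And>m. 0 \<le> y $ m"
  shows "0 < G y $ m"
  using mult_pos_pos[OF normalize_scale_pos[OF assms] update_pos[OF assms]]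
  by (simp add: normalize_power_def)

lemma ex_fixed_point:
  obtains q where "\<And>m. 0 < q $ m" "G q = q"
proof -
  \<comment> \<open>With total weighted power \<open>N * P\<close>, a single component is at most
    \<open>N * P / \<sigma> $ m\<close>, so \<open>G\<close> maps this box into itself. The box may
    contain 0 because \<open>T 0\<close> is positive; positivity of the fixed point follows from its
    being a value of \<open>G\<close>.\<close>
  define S where "S = cbox (0 :: real ^ 'n) (\<chi> m. real N * P / \<sigma> $ m)"
  have nonneg: "0 \<le> x $ m" if "x \<in> S" for x m
    using that by (simp add: S_def mem_box_cart)
  have "G ` S \<subseteq> S"
  proof safe
    fix x assume "x \<in> S"
    note x = nonneg[OF this]
    have "\<sigma> $ m * G x $ m \<le> real N * P" for m
    proof -
      have "\<sigma> $ m * G x $ m \<le> (\<Sum>n\<in>UNIV. \<sigma> $ n * G x $ n)"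
        using \<sigma> normalized_pos[OF x] by (intro member_le_sum) (auto simp: less_imp_le)
      then show ?thesis
        using normalized_power[OF x] by (simp add: inner_vec_def)
    qed
    then show "G x \<in> S"
      using \<sigma> normalized_pos[OF x] by (simp add: S_def mem_box_cart field_simps less_imp_le)
  qed
  moreover have "continuous_on S G"
    unfolding normalize_power_def
  proof (intro continuous_intros continuous_on_update ballI)
    show "\<sigma> \<bullet> T x \<noteq> 0" if "x \<in> S" for x
      using weighted_power_pos[OF update_pos[OF nonneg[OF that]]] by simp
  qed (use nonneg in auto)
  moreover have "0 \<in> S"
    using N P \<sigma> by (simp add: S_def mem_box_cart less_imp_le)
  ultimately obtain q where q: "q \<in> S" "G q = q"
    using brouwer[of S G] compact_cbox convex_box(1) unfolding S_def image_subset_iff_funcset by blast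
  have "0 < q $ m" for m
    using normalized_pos[OF nonneg[OF q(1)], of m] q(2) by simp
  then show thesis
    using q(2) by (rule that)
qed

section \<open>The fixed point as the unique optimum\<close>

context
  fixes k :: real and p :: "real ^ 'n"
  assumes k: "0 < k" "k < 1"
    and contract: "\<And>x y a m. \<lbrakk>\<And>m. 0 \<le> y $ m; 0 < a; a \<le> 1; \<And>m. a * y $ m \<le> x $ m\<rbrakk>
        \<Longrightarrow> a powr k * T y $ m \<le> T x $ m"
    and p_pos: "\<And>m. 0 < p $ m" and p_fixed: "G p = p"
begin

text \<open>This is \<open>contract\<close> with the two points exchanged and
  \<open>a = 1 / b\<close>.\<close>

lemma contract_upper:
  assumes "\<And>m. 0 \<le> x $ m" "1 \<le> b" "\<And>m. x $ m \<le> b * y $ m"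
  shows "T x $ m \<le> b powr k * T y $ m"
proof -
  have "(1 / b) powr k * T x $ m \<le> T y $ m"
    using assms by (intro contract) (auto simp: field_simps)
  then show ?thesis
    using assms(2) by (simp add: powr_divide field_simps)
qed

text \<open>The common value of the ratios \<open>p $ m / T p $ m\<close>, which turns out to be the
  optimal objective value; \<open>p\<close> is a nonlinear eigenvector of \<open>T\<close> with
  eigenvalue \<open>1 / rate\<close>.\<close>

definition rate :: real where "rate = real N * P / (\<sigma> \<bullet> T p)"

lemma rate_pos: "0 < rate"
  unfolding rate_def using p_pos by (intro normalize_scale_pos) (simp add: less_imp_le)

lemma fixed_point_eq: "p $ m = rate * T p $ m"
  using arg_cong[OF p_fixed, of "\<lambda>x. x $ m"] by (simp add: normalize_power_def rate_def)

lemma fixed_point_power: "\<sigma> \<bullet> p = real N * P"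
  using normalized_power[of p] p_pos p_fixed by (simp add: less_imp_le)

lemma fixed_point_feasible: "feasible N \<sigma> P p"
  using fixed_point_power N p_pos by (simp add: feasible_def positive_vec_def)

lemma min_objective_fixed_point: "min_objective N d \<beta> w \<phi> p = rate"
proof -
  have "p $ m / T p $ m = rate" for m
    using fixed_point_eq[of m] update_pos[of p m] p_pos by (simp add: less_imp_le)
  then show ?thesis
    by (simp add: min_objective_eq)
qed

text \<open>Let \<open>a\<close> be the largest ratio \<open>p $ m / q $ m\<close>. If
  \<open>a > 1\<close>, contraction at an index attaining it gives \<open>p $ m\<close> at most
  \<open>a powr k * q $ m\<close>, which is below \<open>a * q $ m = p $ m\<close>. So
  \<open>q\<close> dominates \<open>p\<close>; as \<open>p\<close> exhausts the power budget, they
  agree. Optimality and uniqueness both follow.\<close>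

lemma fixed_point_unique_maximizer:
  assumes q: "feasible N \<sigma> P q" and obj: "rate \<le> min_objective N d \<beta> w \<phi> q"
  shows "q = p"
proof -
  have q_pos: "0 < q $ m" for m
    using q by (simp add: feasible_def positive_vec_def)
  have T_pos: "0 < T q $ m" for m
    using q_pos by (intro update_pos) (simp add: less_imp_le)
  have q_ge: "rate * T q $ m \<le> q $ m" for m
  proof -
    have "min_objective N d \<beta> w \<phi> q \<le> q $ m / T q $ m"
      unfolding min_objective_eq by (intro Min_le) auto
    with obj have "rate \<le> q $ m / T q $ m" by linarith
    then show ?thesis using T_pos[of m] by (simp add: field_simps)
  qed
  define a where "a = Max (range (\<lambda>m. p $ m / q $ m))"
  have a: "p $ m \<le> a * q $ m" for m
  proof -
    have "p $ m / q $ m \<le> a"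
      unfolding a_def by (intro Max_ge) auto
    then show ?thesis
      using q_pos[of m] by (simp add: field_simps)
  qed
  have "a \<in> range (\<lambda>m. p $ m / q $ m)"
    unfolding a_def by (intro Max_in) auto
  then obtain m where "a = p $ m / q $ m" by auto
  then have m: "p $ m = a * q $ m"
    using q_pos[of m] by simp
  have "a \<le> 1"
  proof (rule ccontr)
    assume "\<not> a \<le> 1"
    then have a1: "1 < a" by simp
    have "p $ m = rate * T p $ m" by (rule fixed_point_eq)
    also have "\<dots> \<le> rate * (a powr k * T q $ m)"
      using p_pos a a1 rate_pos by (intro mult_left_mono contract_upper) (auto simp: less_imp_le)
    also have "\<dots> = a powr k * (rate * T q $ m)" by simp
    also have "\<dots> \<le> a powr k * q $ m"
      using q_ge by (intro mult_left_mono) auto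
    also have "\<dots> < a powr 1 * q $ m"
      using a1 k q_pos by (intro mult_strict_right_mono powr_less_mono) auto
    also have "\<dots> = p $ m" using m a1 by simp
    finally show False by simp
  qed
  then have "p $ m \<le> q $ m" for m
    using a[of m] mult_right_mono[of a 1 "q $ m"] q_pos[of m] by linarith
  moreover have "\<sigma> \<bullet> q \<le> \<sigma> \<bullet> p"
    using q N by (simp add: fixed_point_power feasible_def field_simps)
  ultimately show ?thesis
    by (rule weighted_power_mono_eq)
qed

lemma fixed_point_optimal: "optimal N d \<beta> w \<sigma> P \<phi> p"
  using fixed_point_feasible fixed_point_unique_maximizer min_objective_fixed_point
  by (fastforce simp: optimal_def is_arg_max_def)

lemma optimal_unique: "optimal N d \<beta> w \<sigma> P \<phi> q \<Longrightarrow> q = p"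
  using fixed_point_feasible fixed_point_unique_maximizer min_objective_fixed_point
  by (force simp: optimal_def is_arg_max_def)

section \<open>Geometric convergence of the iteration\<close>

lemma normalized_update_step:
  assumes ab: "0 < a" "a \<le> 1" "1 \<le> b"
    and x: "\<And>m. a * p $ m \<le> x $ m" "\<And>m. x $ m \<le> b * p $ m"
  obtains a' b' where "0 < a'" "a' \<le> 1" "1 \<le> b'"
    "\<And>m. a' * p $ m \<le> G x $ m" "\<And>m. G x $ m \<le> b' * p $ m"
    "ln b' - ln a' = k * (ln b - ln a)"
proof -
  have x_nonneg: "0 \<le> x $ m" for m
    using x(1)[of m] ab p_pos[of m] by (meson less_imp_le mult_pos_pos order_trans)
  define s where "s = real N * P / (\<sigma> \<bullet> T x)"
  have s: "0 < s"
    unfolding s_def using x_nonneg by (rule normalize_scale_pos)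
  \<comment> \<open>The powers come from contraction. The factor \<open>s / rate\<close> compares
    the normalizations at \<open>x\<close> and \<open>p\<close>; it is common to both bounds and
    cancels in \<open>ln b' - ln a'\<close>.\<close>
  define a' where "a' = s / rate * a powr k"
  define b' where "b' = s / rate * b powr k"
  have pos: "0 < a'" "0 < b'"
    using s rate_pos ab by (auto simp: a'_def b'_def)
  have Gx: "G x $ m = s * T x $ m" for m
    by (simp add: normalize_power_def s_def)
  have Tp: "T p $ m = p $ m / rate" for m
    using fixed_point_eq[of m] rate_pos by (simp add: field_simps)
  have lower: "a' * p $ m \<le> G x $ m" for m
  proof -
    have "s * (a powr k * T p $ m) \<le> s * T x $ m"
      using s ab x p_pos by (intro mult_left_mono contract) (auto simp: less_imp_le)
    then show ?thesis by (simp add: Gx Tp a'_def mult_ac)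
  qed
  have upper: "G x $ m \<le> b' * p $ m" for m
  proof -
    have "s * T x $ m \<le> s * (b powr k * T p $ m)"
      using s ab x x_nonneg by (intro mult_left_mono contract_upper) (auto simp: less_imp_le)
    then show ?thesis by (simp add: Gx Tp b'_def mult_ac)
  qed
  \<comment> \<open>\<open>G x\<close> and \<open>p\<close> have equal weighted power, so the ratio
    bounds must enclose 1. This restores the hypotheses for the next step.\<close>
  have power: "\<sigma> \<bullet> G x = \<sigma> \<bullet> p" "0 < \<sigma> \<bullet> p"
    using normalized_power[OF x_nonneg] fixed_point_power N P by auto
  have "a' * (\<sigma> \<bullet> p) \<le> \<sigma> \<bullet> G x" "\<sigma> \<bullet> G x \<le> b' * (\<sigma> \<bullet> p)"
    using weighted_power_mono[of "a' *\<^sub>R p" "G x"] weighted_power_mono[of "G x" "b' *\<^sub>R p"] lower upper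
    by auto
  then have "a' \<le> 1" "1 \<le> b'"
    using power by auto
  moreover have "ln b' - ln a' = k * (ln b - ln a)"
    using s rate_pos ab by (simp add: a'_def b'_def ln_mult ln_div ln_powr algebra_simps)
  ultimately show thesis
    using that lower upper pos by blast
qed

text \<open>The logarithmic width of the ratio bounds for \<open>q l\<close> against
  \<open>p\<close> shrinks by the factor \<open>k\<close> per step. As the bounds always enclose 1,
  a small width also gives a small norm distance.\<close>

lemma iteration_geometric:
  fixes q :: "nat \<Rightarrow> real ^ 'n"
  assumes q0: "\<And>m. 0 < q 0 $ m" and step: "\<And>l. q (Suc l) = G (q l)"
  shows "geometrically_converges q p"
proof -
  \<comment> \<open>Inserting 1 makes the initial bounds enclose 1: \<open>q 0\<close> need not have
    the weighted power of \<open>p\<close>.\<close>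
  define a0 where "a0 = Min (insert 1 (range (\<lambda>m. q 0 $ m / p $ m)))"
  define b0 where "b0 = Max (insert 1 (range (\<lambda>m. q 0 $ m / p $ m)))"
  have a0: "0 < a0" "a0 \<le> 1" and b0: "1 \<le> b0"
    unfolding a0_def b0_def using q0 p_pos by (auto simp: Min_gr_iff)
  have ratio_bounds: "a0 \<le> q 0 $ m / p $ m" "q 0 $ m / p $ m \<le> b0" for m
    unfolding a0_def b0_def by (rule Min_le Max_ge; simp)+
  have q0_bounds: "a0 * p $ m \<le> q 0 $ m" "q 0 $ m \<le> b0 * p $ m" for m
    using ratio_bounds[of m] p_pos[of m] by (auto simp: field_simps)
  \<comment> \<open>The added 1 keeps \<open>D\<close>, and so the final constant, positive even
    when \<open>q 0 = p\<close>.\<close>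
  define D where "D = ln b0 - ln a0 + 1"
  have "0 \<le> ln b0" "ln a0 \<le> 0" using a0 b0 by auto
  then have D: "0 < D" by (simp add: D_def)
  have bounds: "\<exists>a b. 0 < a \<and> a \<le> 1 \<and> 1 \<le> b \<and> (\<forall>m. a * p $ m \<le> q l $ m) \<and>
      (\<forall>m. q l $ m \<le> b * p $ m) \<and> ln b - ln a \<le> D * k ^ l" for l
  proof (induction l)
    case 0
    then show ?case
      using a0 b0 q0_bounds by (intro exI[of _ a0] exI[of _ b0]) (auto simp: D_def)
  next
    case (Suc l)
    then obtain a b where ab: "0 < a" "a \<le> 1" "1 \<le> b" "\<And>m. a * p $ m \<le> q l $ m"
      "\<And>m. q l $ m \<le> b * p $ m" and le: "ln b - ln a \<le> D * k ^ l" by blast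
    from normalized_update_step[OF ab] obtain a' b' where ab': "0 < a'" "a' \<le> 1" "1 \<le> b'"
      "\<And>m. a' * p $ m \<le> q (Suc l) $ m" "\<And>m. q (Suc l) $ m \<le> b' * p $ m"
      and eq: "ln b' - ln a' = k * (ln b - ln a)"
      unfolding step by blast
    have "ln b' - ln a' \<le> D * k ^ Suc l"
      unfolding eq using mult_left_mono[OF le, of k] k by (simp add: mult_ac)
    with ab' show ?case by blast
  qed
  \<comment> \<open>\<open>exp D\<close> bounds the upper ratio \<open>b\<close>, \<open>D\<close>
    the initial logarithmic width, and the sum over \<open>p\<close> passes from components to the
    l1 norm.\<close>
  define C where "C = exp D * D * (\<Sum>m\<in>UNIV. p $ m)"
  have "0 < C"
    unfolding C_def using D p_pos by (simp add: sum_pos)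
  moreover have "norm (q l - p) \<le> C * k ^ l" for l
  proof -
    obtain a b where ab: "0 < a" "a \<le> 1" "1 \<le> b" "\<And>m. a * p $ m \<le> q l $ m"
      "\<And>m. q l $ m \<le> b * p $ m" and le: "ln b - ln a \<le> D * k ^ l"
      using bounds[of l] by blast
    have kl: "0 < k ^ l" "k ^ l \<le> 1"
      using k by (auto simp: power_le_one)
    have "D * k ^ l \<le> D" using D kl by simp
    moreover have "ln a \<le> 0" using ab by simp
    ultimately have "ln b \<le> D" using le by linarith
    then have b: "b \<le> exp D" using ab by (metis exp_le_cancel_iff exp_ln less_le_trans zero_less_one)
    \<comment> \<open>The inequality \<open>1 + t\<close> at most \<open>exp t\<close>, at
      \<open>t = ln a - ln b\<close>, turns the logarithmic width into a bound on
      \<open>b - a\<close>.\<close>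
    have "1 - D * k ^ l \<le> 1 + (ln a - ln b)" using le by linarith
    also have "\<dots> \<le> exp (ln a - ln b)" by (rule exp_ge_add_one_self)
    also have "\<dots> = a / b" using ab by (simp add: exp_diff)
    finally have "b - a \<le> b * (D * k ^ l)" using ab by (simp add: field_simps)
    also have "\<dots> \<le> exp D * (D * k ^ l)" using b D kl by (intro mult_right_mono) auto
    finally have ba: "b - a \<le> exp D * D * k ^ l" by (simp add: mult.assoc)
    have "\<bar>(q l - p) $ m\<bar> \<le> exp D * D * k ^ l * p $ m" for m
    proof -
      \<comment> \<open>Since 1 lies between \<open>a\<close> and \<open>b\<close>, both
        \<open>q l $ m\<close> and \<open>p $ m\<close> lie between \<open>a * p $ m\<close> and
        \<open>b * p $ m\<close>.\<close>
      have "a * p $ m \<le> 1 * p $ m" "1 * p $ m \<le> b * p $ m"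
        using ab p_pos[of m] by (auto intro!: mult_right_mono)
      then have "\<bar>(q l - p) $ m\<bar> \<le> (b - a) * p $ m"
        using ab(4,5)[of m] by (simp add: left_diff_distrib abs_le_iff)
      also have "\<dots> \<le> exp D * D * k ^ l * p $ m"
        using ba p_pos[of m] by (intro mult_right_mono) auto
      finally show ?thesis .
    qed
    then have "(\<Sum>m\<in>UNIV. \<bar>(q l - p) $ m\<bar>) \<le> (\<Sum>m\<in>UNIV. exp D * D * k ^ l * p $ m)"
      by (rule sum_mono)
    also have "\<dots> = C * k ^ l"
      by (simp only: C_def flip: sum_distrib_left) (simp only: mult_ac)
    finally show ?thesis
      using norm_le_l1_cart[of "q l - p"] by linarith
  qed
  ultimately show ?thesis
    unfolding geometrically_converges_def using k by blast
qed

end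

end

end

theorem theorem2:
  fixes J K N :: nat
    and P :: real
    and \<beta> w \<sigma> \<phi> :: "real ^ 'n::finite"
    and d :: "real ^ 'n ^ 'n"
  assumes "0 < J" and "0 < K" and "0 < N"
    and "CARD('n) = J * K"
    and "0 < P"
    and "positive_vec \<beta>" and "positive_vec w" and "positive_vec \<sigma>"
    and "\<And>m n. 0 < d $ m $ n"
    and "positive_vec \<phi>"
  shows "\<exists>q_opt. optimal N d \<beta> w \<sigma> P \<phi> q_opt
    \<and> (\<forall>q'. optimal N d \<beta> w \<sigma> P \<phi> q' \<longrightarrow> q' = q_opt)
    \<and> (\<forall>q :: nat \<Rightarrow> real ^ 'n.
          feasible N \<sigma> P (q 0)
          \<and> (\<forall>l. q (Suc l) = normalize_power N \<sigma> P (update N d \<beta> w \<phi> (q l)))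
          \<longrightarrow> geometrically_converges q q_opt)"
proof -
  interpret interference_model N d \<beta> w \<phi>
    using assms by unfold_locales (auto simp: positive_vec_def)
  have \<sigma>: "\<And>m. 0 < \<sigma> $ m"
    using \<open>positive_vec \<sigma>\<close> by (simp add: positive_vec_def)
  obtain k where k: "0 < k" "k < 1"
    and *: "\<forall>x y a m. (\<forall>m. 0 \<le> y $ m) \<longrightarrow> 0 < a \<longrightarrow> a \<le> 1 \<longrightarrow>
        (\<forall>m. a * y $ m \<le> x $ m) \<longrightarrow> a powr k * T y $ m \<le> T x $ m"
    using ex_contraction_factor by (elim exE conjE)
  have contract: "a powr k * T y $ m \<le> T x $ m"
    if "\<And>m. 0 \<le> y $ m" "0 < a" "a \<le> 1" "\<And>m. a * y $ m \<le> x $ m" for x y a m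
    using * that by metis
  \<comment> \<open>Fixing \<open>p\<close> before any sequence is given makes one limit serve all
    starting points.\<close>
  obtain p where p: "\<And>m. 0 < p $ m" "normalize_power N \<sigma> P (T p) = p"
    using ex_fixed_point[OF \<sigma> \<open>0 < P\<close>] by blast
  note facts = \<sigma> \<open>0 < P\<close> k contract p
  show ?thesis
  proof (intro exI[of _ p] conjI allI impI)
    show "optimal N d \<beta> w \<sigma> P \<phi> p"
      by (rule fixed_point_optimal[OF facts])
    show "q' = p" if "optimal N d \<beta> w \<sigma> P \<phi> q'" for q'
      using facts that by (rule optimal_unique)
    show "geometrically_converges q p"
      if "feasible N \<sigma> P (q 0) \<and> (\<forall>l. q (Suc l) = normalize_power N \<sigma> P (T (q l)))" for q
      using that by (intro iteration_geometric[OF facts]) (auto simp: feasible_def positive_vec_def)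
  qed
qed

end
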